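(* Let $\mathbb F$ be an algebraically closed field of characteristic $2$ and let $\mathcal H$ be the Heisenberg algebra with basis $x,y,z$ and $[x,y]=z$, $z$ central. Up to isomorphism of restricted Lie algebras there are exactly two restricted Heisenberg algebras, and they are non-isomorphic; they are given respectively by the linear forms $\theta=0$ and $\theta=z^*$.
   Context: A restricted Heisenberg algebra is $\mathcal H$ endowed with a $2$-map, i.e. a map $(\cdot)^{[2]}$ with $(\lambda u)^{[2]}=\lambda^2u^{[2]}$, $[u,v^{[2]}]=[[u,v],v]$, $(u+v)^{[2]}=u^{[2]}+v^{[2]}+[u,v]$. Any such map takes values in $\mathbb Fz$ on basis elements and is given by a linear form $\theta:\mathcal H\to\mathbb F$ via $x^{[2]}=\theta(x)z$, $y^{[2]}=\theta(y)z$, $z^{[2]}=\theta(z)z$, that is $(ax+by+cz)^{[2]}=(a^2\theta(x)+b^2\theta(y)+c^2\theta(z)+ab)z$. $z^*$ is the element of the dual basis dual to $z$. An isomorphism of restricted Lie algebras is a Lie isomorphism commuting with the $2$-maps. *)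

theory Defs
  imports "HOL-Computational_Algebra.Computational_Algebra"
begin

locale lie_algebra = vector_space scale
  for scale :: "'k::field \<Rightarrow> 'v::ab_group_add \<Rightarrow> 'v" (infixr \<open>*s\<close> 75) +
  fixes bracket :: "'v \<Rightarrow> 'v \<Rightarrow> 'v"
  assumes linear_left: "Vector_Spaces.linear scale scale (\<lambda>u. bracket u v)"
    and linear_right: "Vector_Spaces.linear scale scale (\<lambda>v. bracket u v)"
    and alternating: "bracket u u = 0"
    and jacobi: "bracket u (bracket v w) + bracket v (bracket w u) + bracket w (bracket u v) = 0"

(* The axioms on sq are those of a 2-map; they are meaningful over fields of
   characteristic 2, which is assumed separately where the locale is used. *)
locale restricted_lie_algebra = lie_algebra +
  fixes sq :: "'b \<Rightarrow> 'b"
  assumes sq_scale: "sq (scale c u) = scale (c ^ 2) (sq u)"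
    and bracket_sq: "bracket u (sq v) = bracket (bracket u v) v"
    and sq_add: "sq (u + v) = sq u + sq v + bracket u v"

definition restricted_lie_isomorphism ::
    "('k::field \<Rightarrow> 'v::ab_group_add \<Rightarrow> 'v) \<Rightarrow> ('v \<Rightarrow> 'v \<Rightarrow> 'v) \<Rightarrow> ('v \<Rightarrow> 'v) \<Rightarrow>
     ('k \<Rightarrow> 'w::ab_group_add \<Rightarrow> 'w) \<Rightarrow> ('w \<Rightarrow> 'w \<Rightarrow> 'w) \<Rightarrow> ('w \<Rightarrow> 'w) \<Rightarrow> ('v \<Rightarrow> 'w) \<Rightarrow> bool"
  where "restricted_lie_isomorphism scale1 bracket1 sq1 scale2 bracket2 sq2 f \<longleftrightarrow>
    Vector_Spaces.linear scale1 scale2 f \<and> bij f \<and>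
    (\<forall>u v. f (bracket1 u v) = bracket2 (f u) (f v)) \<and>
    (\<forall>u. f (sq1 u) = sq2 (f u))"

definition restricted_lie_isomorphic ::
    "('k::field \<Rightarrow> 'v::ab_group_add \<Rightarrow> 'v) \<Rightarrow> ('v \<Rightarrow> 'v \<Rightarrow> 'v) \<Rightarrow> ('v \<Rightarrow> 'v) \<Rightarrow>
     ('k \<Rightarrow> 'w::ab_group_add \<Rightarrow> 'w) \<Rightarrow> ('w \<Rightarrow> 'w \<Rightarrow> 'w) \<Rightarrow> ('w \<Rightarrow> 'w) \<Rightarrow> bool"
  where "restricted_lie_isomorphic scale1 bracket1 sq1 scale2 bracket2 sq2 \<longleftrightarrow>
    (\<exists>f. restricted_lie_isomorphism scale1 bracket1 sq1 scale2 bracket2 sq2 f)"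

locale heisenberg_algebra = lie_algebra scale bracket
  for scale :: "'k::field \<Rightarrow> 'v::ab_group_add \<Rightarrow> 'v" (infixr \<open>*s\<close> 75)
    and bracket :: "'v \<Rightarrow> 'v \<Rightarrow> 'v" +
  fixes x y z :: 'v
  assumes distinct_basis: "distinct [x, y, z]"
    and independent_basis: "independent {x, y, z}"
    and span_basis: "span {x, y, z} = UNIV"
    and bracket_xy: "bracket x y = z"
    and z_central: "bracket u z = 0"
begin

definition dual_basis :: "'v \<Rightarrow> 'v \<Rightarrow> 'k"
  where "dual_basis b u = representation {x, y, z} u b"

(* (a x + b y + c z)^[2] = (a^2 theta(x) + b^2 theta(y) + c^2 theta(z) + a b) z *)
definition two_map :: "('v \<Rightarrow> 'k) \<Rightarrow> 'v \<Rightarrow> 'v"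
  where "two_map \<theta> u =
    ((dual_basis x u)\<^sup>2 * \<theta> x + (dual_basis y u)\<^sup>2 * \<theta> y + (dual_basis z u)\<^sup>2 * \<theta> z
      + dual_basis x u * dual_basis y u) *s z"

end

end

theory Submission
  imports Defs
begin

text \<open>
  Squares are central, hence multiples of \<open>z\<close>, so a 2-map is determined by the three scalars
  describing the squares of \<open>x\<close>, \<open>y\<close>, \<open>z\<close>. Any \<open>X\<close>, \<open>Y\<close> with \<open>Z = [X, Y] \<noteq> 0\<close> again form a
  Heisenberg basis \<open>X\<close>, \<open>Y\<close>, \<open>Z\<close>, and equal scalars with respect to two such bases yield an
  isomorphism. If the square of \<open>z\<close> vanishes, a root of \<open>\<beta> t\<^sup>2 + t + \<alpha>\<close> makes \<open>x + t y\<close> square to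
  zero, and adding a multiple of this vector to \<open>y\<close> does the same for \<open>y\<close>. Otherwise we rescale
  so that \<open>z\<close> squares to itself and correct \<open>x\<close> and \<open>y\<close> by multiples of \<open>z\<close>, using square roots.
  The two cases differ in whether the derived algebra, spanned by \<open>z\<close>, squares to zero.
\<close>

section \<open>Bilinearity and antisymmetry of the bracket\<close>

context lie_algebra
begin

lemma bracket_add_left: "bracket (u + v) w = bracket u w + bracket v w"
  and bracket_scale_left: "bracket (c *s u) w = c *s bracket u w"
  and bracket_add_right: "bracket w (u + v) = bracket w u + bracket w v"
  and bracket_scale_right: "bracket w (c *s u) = c *s bracket w u"
  using linear_left[of w] linear_right[of w] by (auto simp: Vector_Spaces.linear_iff)

lemma bracket_zero_left [simp]: "bracket 0 w = 0"
  using bracket_scale_left[of 0 0 w] by simp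

lemma bracket_zero_right [simp]: "bracket w 0 = 0"
  using bracket_scale_right[of w 0 0] by simp

lemma bracket_swap: "bracket v u = - bracket u v"
proof -
  have "bracket (u + v) (u + v) = bracket u v + bracket v u"
    unfolding bracket_add_left bracket_add_right by (simp add: alternating)
  then show ?thesis
    by (simp add: alternating eq_neg_iff_add_eq_0 add.commute)
qed

lemmas bracket_simps = bracket_add_left bracket_add_right bracket_scale_left bracket_scale_right
  alternating

end

section \<open>Coordinates, centre and bases of a Heisenberg algebra\<close>

context heisenberg_algebra
begin

lemma z_central_left: "bracket z u = 0"
  using bracket_swap[of z u] z_central by simp

lemma bracket_yx: "bracket y x = - z"
  using bracket_swap[of y x] bracket_xy by simp

lemma z_nonzero: "z \<noteq> 0"
  using independent_basis dependent_zero[of "{x, y, z}"] by auto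

lemma dual_basis_add: "dual_basis b (u + v) = dual_basis b u + dual_basis b v"
  by (simp add: dual_basis_def representation_add[OF independent_basis] span_basis)

lemma dual_basis_scale: "dual_basis b (c *s u) = c * dual_basis b u"
  by (simp add: dual_basis_def representation_scale[OF independent_basis] span_basis)

lemma dual_basis_basis:
  "dual_basis x x = 1" "dual_basis x y = 0" "dual_basis x z = 0"
  "dual_basis y x = 0" "dual_basis y y = 1" "dual_basis y z = 0"
  "dual_basis z x = 0" "dual_basis z y = 0" "dual_basis z z = 1"
  using distinct_basis by (auto simp: dual_basis_def representation_basis[OF independent_basis])

lemma coordinates: "dual_basis x u *s x + dual_basis y u *s y + dual_basis z u *s z = u"
  using sum_representation_eq[OF independent_basis, of u "{x, y, z}"] distinct_basis
  by (simp add: span_basis dual_basis_def add.assoc)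

lemma dual_basis_coordinates:
  "dual_basis x (a *s x + b *s y + c *s z) = a"
  "dual_basis y (a *s x + b *s y + c *s z) = b"
  "dual_basis z (a *s x + b *s y + c *s z) = c"
  by (simp_all add: dual_basis_add dual_basis_scale dual_basis_basis)

lemma bracket_coordinates:
  "bracket u v = (dual_basis x u * dual_basis y v - dual_basis y u * dual_basis x v) *s z"
proof -
  define a b c where "a = dual_basis x u" and "b = dual_basis y u" and "c = dual_basis z u"
  define a' b' c' where "a' = dual_basis x v" and "b' = dual_basis y v" and "c' = dual_basis z v"
  have "bracket (a *s x + b *s y + c *s z) (a' *s x + b' *s y + c' *s z) = (a * b' - b * a') *s z"
    by (simp add: bracket_simps z_central z_central_left bracket_xy bracket_yx
        scale_left_diff_distrib mult_ac)
  then show ?thesis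
    unfolding a_def b_def c_def a'_def b'_def c'_def coordinates .
qed

text \<open>Bracketing with \<open>x\<close> and \<open>y\<close> reads off, up to sign, the
  \<open>y\<close>- and \<open>x\<close>-coordinates of \<open>v\<close> as multiples of
  \<open>z\<close>.\<close>

lemma centralE:
  assumes "\<And>u. bracket u v = 0"
  obtains c where "v = c *s z"
proof -
  have "dual_basis y v = 0" "dual_basis x v = 0"
    using assms[of x] assms[of y] z_nonzero by (auto simp: bracket_coordinates dual_basis_basis)
  then show thesis
    using coordinates[of v] that[of "dual_basis z v"] by simp
qed

text \<open>All brackets are multiples of \<open>z\<close>, so the new third vector is central;
  independence comes from bracketing a relation, spanning from a dimension count.\<close>

lemma heisenberg_algebra_bracket_basis:
  assumes "bracket X Y \<noteq> 0"
  shows "heisenberg_algebra scale bracket X Y (bracket X Y)"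
proof -
  define Z where "Z = bracket X Y"
  have Z: "Z \<noteq> 0"
    using assms by (simp add: Z_def)
  have central: "bracket u Z = 0" "bracket Z u = 0" for u
    by (simp_all add: Z_def bracket_coordinates[of X Y] bracket_scale_right bracket_scale_left
        z_central z_central_left)
  have YX: "bracket Y X = - Z"
    by (simp add: Z_def bracket_swap[of Y X])
  have eq0: "a = 0 \<and> b = 0 \<and> c = 0" if "a *s X + b *s Y + c *s Z = 0" for a b c
  proof -
    \<comment> \<open>Bracketing the relation with \<open>Y\<close> isolates \<open>a\<close>, with
      \<open>X\<close> isolates \<open>b\<close>; then \<open>c *s Z = 0\<close> remains.\<close>
    have "bracket (a *s X + b *s Y + c *s Z) Y = a *s Z"
      "bracket (a *s X + b *s Y + c *s Z) X = - (b *s Z)"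
      using YX by (simp_all add: bracket_simps central Z_def [symmetric])
    then show ?thesis
      using that Z by simp
  qed
  have distinct: "distinct [X, Y, Z]"
    using eq0[of 1 "-1" 0] eq0[of 1 0 "-1"] eq0[of 0 1 "-1"] by auto
  have indep: "independent {X, Y, Z}"
  proof
    assume "dependent {X, Y, Z}"
    then obtain k where k: "\<exists>v\<in>{X, Y, Z}. k v \<noteq> 0" "(\<Sum>v\<in>{X, Y, Z}. k v *s v) = 0"
      using dependent_finite[of "{X, Y, Z}"] by blast
    have "k X *s X + k Y *s Y + k Z *s Z = 0"
      using k(2) distinct by (simp add: add.assoc)
    from eq0[OF this] k(1) show False
      by blast
  qed
  have "span {X, Y, Z} = UNIV"
  proof (rule ccontr)
    assume "span {X, Y, Z} \<noteq> UNIV"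
    then obtain v where v: "v \<notin> span {X, Y, Z}"
      using UNIV_eq_I[of "span {X, Y, Z}"] by metis
    then have "v \<notin> {X, Y, Z}"
      using span_base[of v "{X, Y, Z}"] by argo
    \<comment> \<open>A vector outside the span would give four independent vectors in the span of
      three.\<close>
    then have "card (insert v {X, Y, Z}) = 4"
      using distinct by simp
    moreover have "card (insert v {X, Y, Z}) \<le> card {x, y, z}"
      using independent_span_bound[of "{x, y, z}" "insert v {X, Y, Z}"]
        independent_insertI[OF v indep] span_basis by simp
    ultimately show False
      using distinct_basis by simp
  qed
  with distinct indep central show ?thesis
    unfolding Z_def by unfold_locales auto
qed

section \<open>2-maps on a Heisenberg algebra\<close>

lemma two_map_basis: "two_map \<theta> x = \<theta> x *s z" "two_map \<theta> y = \<theta> y *s z" "two_map \<theta> z = \<theta> z *s z"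
  by (simp_all add: two_map_def dual_basis_basis)

text \<open>Characteristic 2 enters in additivity: squaring is additive, and the mixed terms of
  \<open>(a + a') * (b + b')\<close> agree with the bracket coefficient
  \<open>a * b' - b * a'\<close>.\<close>

lemma restricted_lie_algebra_two_map:
  assumes "CHAR('k) = 2"
  shows "restricted_lie_algebra scale bracket (two_map \<theta>)"
proof unfold_locales
  have two: "(2 :: 'k) = 0"
    using of_nat_CHAR[where 'a = 'k] assms by simp
  fix u v :: 'v and c :: 'k
  show "two_map \<theta> (c *s u) = c\<^sup>2 *s two_map \<theta> u"
    by (simp add: two_map_def dual_basis_scale algebra_simps power2_eq_square)
  show "bracket u (two_map \<theta> v) = bracket (bracket u v) v"
    by (simp add: two_map_def bracket_coordinates[of u v] bracket_simps z_central z_central_left)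
  show "two_map \<theta> (u + v) = two_map \<theta> u + two_map \<theta> v + bracket u v"
    unfolding two_map_def bracket_coordinates[of u v] scale_left_distrib [symmetric]
    by (rule arg_cong[of _ _ "\<lambda>t. t *s z"])
      (simp add: dual_basis_add power2_sum two minus_CHAR_2[OF assms] distrib_left distrib_right ac_simps)
qed

lemma sq_coordinates:
  assumes "restricted_lie_algebra scale bracket sq"
  shows "sq (a *s x + b *s y + c *s z) = a\<^sup>2 *s sq x + b\<^sup>2 *s sq y + c\<^sup>2 *s sq z + (a * b) *s z"
proof -
  interpret restricted_lie_algebra scale bracket sq
    by fact
  show ?thesis
    by (simp add: sq_add sq_scale bracket_simps z_central bracket_xy algebra_simps)
qed

text \<open>Since \<open>bracket u v\<close> is a multiple of the central \<open>z\<close>,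
  bracketing it with \<open>v\<close> gives 0, so \<open>sq v\<close> is central.\<close>

lemma sq_in_centerE:
  assumes "restricted_lie_algebra scale bracket sq"
  obtains c where "sq v = c *s z"
proof -
  interpret restricted_lie_algebra scale bracket sq
    by fact
  have "bracket u (sq v) = 0" for u
    by (simp add: bracket_sq bracket_coordinates[of u v] bracket_scale_left z_central_left)
  then show thesis
    using centralE[of "sq v"] that by metis
qed

end

section \<open>Isomorphisms from matching bases\<close>

text \<open>The linear map matching the two bases works, because bracket and 2-map are given by the
  same coordinate formulas on both sides.\<close>

lemma restricted_heisenberg_isomorphicI:
  fixes scale1 :: "'k::field \<Rightarrow> 'v::ab_group_add \<Rightarrow> 'v"
    and scale2 :: "'k \<Rightarrow> 'w::ab_group_add \<Rightarrow> 'w"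
  assumes "heisenberg_algebra scale1 bracket1 x1 y1 z1"
    and "heisenberg_algebra scale2 bracket2 x2 y2 z2"
    and restricted1: "restricted_lie_algebra scale1 bracket1 sq1"
    and restricted2: "restricted_lie_algebra scale2 bracket2 sq2"
    and sq1: "sq1 x1 = scale1 \<alpha> z1" "sq1 y1 = scale1 \<beta> z1" "sq1 z1 = scale1 \<gamma> z1"
    and sq2: "sq2 x2 = scale2 \<alpha> z2" "sq2 y2 = scale2 \<beta> z2" "sq2 z2 = scale2 \<gamma> z2"
  shows "restricted_lie_isomorphic scale1 bracket1 sq1 scale2 bracket2 sq2"
proof -
  interpret H1: heisenberg_algebra scale1 bracket1 x1 y1 z1 by fact
  interpret H2: heisenberg_algebra scale2 bracket2 x2 y2 z2 by fact
  define f where "f u = scale2 (H1.dual_basis x1 u) x2 + scale2 (H1.dual_basis y1 u) y2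
    + scale2 (H1.dual_basis z1 u) z2" for u
  define g where "g u = scale1 (H2.dual_basis x2 u) x1 + scale1 (H2.dual_basis y2 u) y1
    + scale1 (H2.dual_basis z2 u) z1" for u
  have coords: "H2.dual_basis x2 (f u) = H1.dual_basis x1 u"
    "H2.dual_basis y2 (f u) = H1.dual_basis y1 u" for u
    unfolding f_def by (simp_all only: H2.dual_basis_coordinates)
  have "g (f u) = u" "f (g w) = w" for u w
    by (simp_all only: f_def g_def H1.dual_basis_coordinates H2.dual_basis_coordinates
        H1.coordinates H2.coordinates)
  then have "bij f"
    by (intro o_bij[of g]) auto
  moreover have linear: "Vector_Spaces.linear scale1 scale2 f"
    unfolding Vector_Spaces.linear_iff
    by (auto simp: f_def H1.dual_basis_add H1.dual_basis_scale H1.vector_space_axioms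
        H2.vector_space_axioms H2.scale_left_distrib H2.scale_right_distrib)
  then interpret f: Vector_Spaces.linear scale1 scale2 f .
  have f_z: "f z1 = z2"
    by (simp add: f_def H1.dual_basis_basis)
  have "f (bracket1 u v) = bracket2 (f u) (f v)" for u v
    by (simp add: H1.bracket_coordinates[of u v] H2.bracket_coordinates[of "f u"] coords f.scale f_z)
  moreover have "f (sq1 u) = sq2 (f u)" for u
  proof -
    let ?a = "H1.dual_basis x1 u" and ?b = "H1.dual_basis y1 u" and ?c = "H1.dual_basis z1 u"
    have "f (sq1 u) = f (sq1 (scale1 ?a x1 + scale1 ?b y1 + scale1 ?c z1))"
      by (simp only: H1.coordinates)
    also have "\<dots> = sq2 (scale2 ?a x2 + scale2 ?b y2 + scale2 ?c z2)"
      unfolding H1.sq_coordinates[OF restricted1] H2.sq_coordinates[OF restricted2]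
      by (simp add: sq1 sq2 f.add f.scale f_z)
    finally show ?thesis
      by (simp only: f_def)
  qed
  ultimately show ?thesis
    using linear unfolding restricted_lie_isomorphic_def restricted_lie_isomorphism_def by blast
qed

section \<open>Normal forms of the 2-map\<close>

text \<open>The linear coefficient 1 keeps the polynomial nonconstant even if \<beta> is 0.\<close>

lemma alg_closed_artin_schreier_root:
  fixes \<alpha> \<beta> :: "'k::alg_closed_field"
  obtains t where "\<beta> * t\<^sup>2 + t + \<alpha> = 0"
proof -
  obtain t where "poly [:\<alpha>, 1, \<beta>:] t = 0"
    using alg_closed_imp_poly_has_root[of "[:\<alpha>, 1, \<beta>:]"] by auto
  then show thesis
    by (intro that[of t]) (simp add: algebra_simps power2_eq_square)
qed

lemma heisenberg_normal_basis:
  fixes scale :: "'k::alg_closed_field \<Rightarrow> 'v::ab_group_add \<Rightarrow> 'v" (infixr \<open>*s\<close> 75)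
  assumes char2: "CHAR('k) = 2"
    and heisenberg: "heisenberg_algebra scale bracket x y z"
    and restricted: "restricted_lie_algebra scale bracket sq"
  obtains X Y Z where "heisenberg_algebra scale bracket X Y Z"
    "sq X = 0" "sq Y = 0" "sq Z = 0 \<or> sq Z = Z"
proof -
  interpret heisenberg_algebra scale bracket x y z by fact
  interpret restricted_lie_algebra scale bracket sq by fact
  have add_self: "a + a = 0" for a :: 'k
    using minus_CHAR_2[OF char2, of a a] by simp
  have neg_z: "- z = z"
    using scale_minus_left[of 1 z] uminus_CHAR_2[OF char2, of 1] by simp
  obtain \<alpha> \<beta> \<gamma> where sq_basis: "sq x = \<alpha> *s z" "sq y = \<beta> *s z" "sq z = \<gamma> *s z"
    using sq_in_centerE[OF restricted] by metis
  show thesis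
  proof (cases "\<gamma> = 0")
    case True
    obtain t where t: "\<beta> * t\<^sup>2 + t + \<alpha> = 0"
      using alg_closed_artin_schreier_root .
    define X where "X = x + t *s y"
    \<comment> \<open>As \<open>sq X = 0\<close> and \<open>bracket y X = z\<close>, the square of
      \<open>Y\<close> is \<open>(\<beta> + \<beta>) *s z\<close>, while \<open>bracket X Y\<close>
      is still \<open>z\<close>.\<close>
    define Y where "Y = y + \<beta> *s X"
    have "sq X = (\<beta> * t\<^sup>2 + t + \<alpha>) *s z"
      by (simp add: X_def sq_add sq_scale sq_basis bracket_simps bracket_xy algebra_simps)
    then have sq_X: "sq X = 0"
      by (simp add: t)
    have yX: "bracket y X = z"
      by (simp add: X_def bracket_simps bracket_yx neg_z)
    have sq_Y: "sq Y = 0"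
      by (simp add: Y_def sq_add sq_scale sq_X sq_basis bracket_simps yX
          scale_left_distrib [symmetric] add_self)
    have XY: "bracket X Y = z"
      by (simp add: Y_def X_def bracket_simps bracket_xy bracket_yx scale_right_distrib)
    show thesis
      using heisenberg_algebra_bracket_basis[of X Y] XY z_nonzero sq_X sq_Y sq_basis True that
      by simp
  next
    case False
    \<comment> \<open>Scaling \<open>x\<close> by \<open>l\<close> scales the bracket to
      \<open>l *s z\<close>, whose square \<open>(l\<^sup>2 * \<gamma>) *s z\<close> is again
      \<open>l *s z\<close>.\<close>
    define l where "l = inverse \<gamma>"
    have l: "l * \<gamma> = 1" "l \<noteq> 0"
      using False by (simp_all add: l_def)
    \<comment> \<open>The coefficient of \<open>sq X\<close> is
      \<open>l\<^sup>2 * \<alpha> + c\<^sup>2 * \<gamma>\<close>; in characteristic 2 it vanishes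
      when the two summands agree. The choice of \<open>d\<close> does the same for
      \<open>Y\<close>.\<close>
    obtain c where c: "c\<^sup>2 = l ^ 3 * \<alpha>"
      using nth_root_exists[of 2] by auto
    obtain d where d: "d\<^sup>2 = l * \<beta>"
      using nth_root_exists[of 2] by auto
    define X where "X = l *s x + c *s z"
    define Y where "Y = y + d *s z"
    have XY: "bracket X Y = l *s z"
      by (simp add: X_def Y_def bracket_simps bracket_xy z_central z_central_left)
    have "l\<^sup>2 * \<alpha> + l ^ 3 * \<alpha> * \<gamma> = l\<^sup>2 * \<alpha> + l\<^sup>2 * \<alpha> * (l * \<gamma>)"
      by (simp add: power2_eq_square power3_eq_cube)
    then have "l\<^sup>2 * \<alpha> + c\<^sup>2 * \<gamma> = 0"
      using add_self by (simp add: c l)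
    then have sq_X: "sq X = 0"
      by (simp add: X_def sq_add sq_scale sq_basis bracket_simps z_central
          scale_left_distrib [symmetric])
    have "\<beta> + l * \<beta> * \<gamma> = \<beta> + \<beta> * (l * \<gamma>)"
      by simp
    then have "\<beta> + d\<^sup>2 * \<gamma> = 0"
      using add_self by (simp add: d l)
    then have sq_Y: "sq Y = 0"
      by (simp add: Y_def sq_add sq_scale sq_basis bracket_simps z_central
          scale_left_distrib [symmetric])
    have "sq (l *s z) = l *s z"
      using l by (simp add: sq_scale sq_basis power2_eq_square mult.assoc)
    then show thesis
      using heisenberg_algebra_bracket_basis[of X Y] XY z_nonzero sq_X sq_Y l that by simp
  qed
qed

section \<open>Non-isomorphism and the classification\<close>

text \<open>An isomorphism preserves the derived algebra, so it sends \<open>z1\<close> to a nonzero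
  multiple \<open>l\<close> of \<open>z2\<close>, whose square is \<open>l\<^sup>2\<close> times
  that of \<open>z2\<close>.\<close>

lemma restricted_heisenberg_sq_z_nonzero:
  assumes "heisenberg_algebra scale1 bracket1 x1 y1 z1"
    and "heisenberg_algebra scale2 bracket2 x2 y2 z2"
    and "restricted_lie_algebra scale2 bracket2 sq2"
    and iso: "restricted_lie_isomorphic scale1 bracket1 sq1 scale2 bracket2 sq2"
    and "sq2 z2 \<noteq> 0"
  shows "sq1 z1 \<noteq> 0"
proof -
  interpret H1: heisenberg_algebra scale1 bracket1 x1 y1 z1 by fact
  interpret H2: heisenberg_algebra scale2 bracket2 x2 y2 z2 by fact
  interpret R2: restricted_lie_algebra scale2 bracket2 sq2 by fact
  obtain f where f: "Vector_Spaces.linear scale1 scale2 f" "inj f"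
      "\<And>u v. f (bracket1 u v) = bracket2 (f u) (f v)" "\<And>u. f (sq1 u) = sq2 (f u)"
    using iso unfolding restricted_lie_isomorphic_def restricted_lie_isomorphism_def
    by (auto dest: bij_is_inj)
  interpret f: Vector_Spaces.linear scale1 scale2 f by fact
  obtain l where l: "f z1 = scale2 l z2"
    using f(3)[of x1 y1] H2.bracket_coordinates[of "f x1" "f y1"] H1.bracket_xy by auto
  have "f z1 \<noteq> 0"
    using f(2) H1.z_nonzero f.zero by (metis injD)
  then have "sq2 (f z1) \<noteq> 0"
    using l assms(5) by (simp add: R2.sq_scale)
  then show ?thesis
    using f(4)[of z1] f.zero by auto
qed

theorem theorem5p26:
  fixes scale :: "'k::alg_closed_field \<Rightarrow> 'v::ab_group_add \<Rightarrow> 'v"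
    and bracket :: "'v \<Rightarrow> 'v \<Rightarrow> 'v"
    and x y z :: 'v
    and sq_zero sq_zstar :: "'v \<Rightarrow> 'v"
  assumes char2: "CHAR('k) = 2"
    and heisenberg: "heisenberg_algebra scale bracket x y z"
  defines "sq_zero \<equiv> heisenberg_algebra.two_map scale x y z (\<lambda>_. 0)"
    and "sq_zstar \<equiv> heisenberg_algebra.two_map scale x y z
                      (heisenberg_algebra.dual_basis scale x y z z)"
  shows "restricted_lie_algebra scale bracket sq_zero
    \<and> restricted_lie_algebra scale bracket sq_zstar
    \<and> \<not> restricted_lie_isomorphic scale bracket sq_zero scale bracket sq_zstar
    \<and> (\<forall>sq. restricted_lie_algebra scale bracket sq \<longrightarrow>
          restricted_lie_isomorphic scale bracket sq scale bracket sq_zero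
        \<or> restricted_lie_isomorphic scale bracket sq scale bracket sq_zstar)"
proof -
  interpret heisenberg_algebra scale bracket x y z by fact
  have restricted: "restricted_lie_algebra scale bracket sq_zero"
    "restricted_lie_algebra scale bracket sq_zstar"
    unfolding sq_zero_def sq_zstar_def by (rule restricted_lie_algebra_two_map[OF char2])+
  have sq_zero: "sq_zero x = 0" "sq_zero y = 0" "sq_zero z = 0"
    by (simp_all add: sq_zero_def two_map_basis)
  have sq_zstar: "sq_zstar x = 0" "sq_zstar y = 0" "sq_zstar z = z"
    by (simp_all add: sq_zstar_def two_map_basis dual_basis_basis)
  \<comment> \<open>An isomorphism would carry the nonzero square of \<open>z\<close> under
    \<open>sq_zstar\<close> back to a nonzero \<open>sq_zero z\<close>.\<close>
  have "\<not> restricted_lie_isomorphic scale bracket sq_zero scale bracket sq_zstar"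
    using restricted_heisenberg_sq_z_nonzero[OF heisenberg heisenberg restricted(2)]
      sq_zero sq_zstar z_nonzero by metis
  moreover have "restricted_lie_isomorphic scale bracket sq scale bracket sq_zero
      \<or> restricted_lie_isomorphic scale bracket sq scale bracket sq_zstar"
    if sq: "restricted_lie_algebra scale bracket sq" for sq
  proof -
    obtain X Y Z where XYZ: "heisenberg_algebra scale bracket X Y Z"
      "sq X = 0" "sq Y = 0" "sq Z = 0 \<or> sq Z = Z"
      using heisenberg_normal_basis[OF char2 heisenberg sq] .
    from XYZ(4) show ?thesis
    proof
      assume "sq Z = 0"
      then show ?thesis
        using restricted_heisenberg_isomorphicI[OF XYZ(1) heisenberg sq restricted(1),
            where \<alpha> = 0 and \<beta> = 0 and \<gamma> = 0] XYZ sq_zero by simp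
    next
      assume "sq Z = Z"
      then show ?thesis
        using restricted_heisenberg_isomorphicI[OF XYZ(1) heisenberg sq restricted(2),
            where \<alpha> = 0 and \<beta> = 0 and \<gamma> = 1] XYZ sq_zstar by simp
    qed
  qed
  ultimately show ?thesis
    using restricted by blast
qed

end
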